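(* Let $V$ be a closed isometric operator in a Hilbert space $H$, and let $C$ be a linear bounded operator in $H$ with $D(C)=N_0$, $R(C)\subseteq N_\infty$. Let $\zeta\in\mathbb{T}$, and let $\zeta^{-1}$ be a point of the regular type of the operator $V$. Then $$R\left(V^+_{0;C}-\zeta^{-1}E_H\right)=H$$ if and only if the following two conditions hold: $$(C-W_\zeta)N_0=N_\infty;\qquad P^H_{M_\infty}M_\zeta=M_\infty.$$
   Context: All Hilbert spaces are complex and separable. $\mathbb{T}=\{z\in\mathbb{C}:|z|=1\}$. A closed isometric operator $V$ in $H$ is a linear isometry defined on a closed subspace $D(V)\subseteq H$ with range $R(V)\subseteq H$. $R(A)$ denotes the range of an operator $A$, $E_H$ is the identity on $H$, and $P^H_{L}$ is the orthogonal projection of $H$ onto a closed subspace $L$. Set $M_\zeta=(E_H-\zeta V)D(V)$, $N_\zeta=H\ominus M_\zeta$ for $\zeta\in\mathbb{C}$ (orthogonal complement), and $M_\infty=R(V)$, $N_\infty=H\ominus R(V)$. In particular $M_0=D(V)$, $N_0=H\ominus D(V)$. Set $V^+_{0;C}=V\oplus C$, i.e. the operator on $H=M_0\oplus N_0$ acting as $V$ on $M_0$ and as $C$ on $N_0$. A point $\lambda\in\mathbb{C}$ is a point of the regular type of $V$ if $V-\lambda E_H$ has a bounded inverse defined on its range. For $\zeta\in\mathbb{T}$ the operator $W_\zeta$, with domain $D(W_\zeta)=P^H_{N_0}N_\zeta$, is defined by $$W_\zeta P^H_{N_0}f=\zeta^{-1}P^H_{N_\infty}f,\quad f\in N_\zeta.$$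 It is well defined and isometric; when $\zeta^{-1}$ is a point of the regular type of $V$ one has $D(W_\zeta)=N_0$ and $R(W_\zeta)=N_\infty$. *)

theory Defs
  imports "HOL-Analysis.Analysis"
begin

text \<open>
  Complex Hilbert spaces, as a type class on top of the real ones: a complex scalar multiplication
  extending the real one, and a sesquilinear form, linear in the first argument, whose
  real part is the real inner product.  Norm and topology are therefore those given by
  \<open>norm x = sqrt (Re (cinner x x))\<close>; positive definiteness comes from \<^class>\<open>real_inner\<close>.
  Separability is not part of the class.
\<close>

class complex_hilbert = real_inner + complete_space +
  fixes scaleC :: "complex \<Rightarrow> 'a \<Rightarrow> 'a"  (infixr \<open>*\<^sub>C\<close> 75)
    and cinner :: "'a \<Rightarrow> 'a \<Rightarrow> complex"
  assumes scaleC_add_right: "a *\<^sub>C (x + y) = a *\<^sub>C x + a *\<^sub>C y"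
    and scaleC_add_left: "(a + b) *\<^sub>C x = a *\<^sub>C x + b *\<^sub>C x"
    and scaleC_scaleC: "a *\<^sub>C (b *\<^sub>C x) = (a * b) *\<^sub>C x"
    and scaleC_of_real: "complex_of_real r *\<^sub>C x = r *\<^sub>R x"
    and cinner_commute: "cinner x y = cnj (cinner y x)"
    and cinner_add_left: "cinner (x + y) z = cinner x z + cinner y z"
    and cinner_scaleC_left: "cinner (a *\<^sub>C x) y = a * cinner x y"
    and Re_cinner: "Re (cinner x y) = inner x y"

instantiation complex :: complex_hilbert
begin

definition scaleC_complex :: "complex \<Rightarrow> complex \<Rightarrow> complex"
  where "scaleC_complex a x = a * x"

definition cinner_complex :: "complex \<Rightarrow> complex \<Rightarrow> complex"
  where "cinner_complex x y = x * cnj y"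

instance
  by standard
    (auto simp: scaleC_complex_def cinner_complex_def algebra_simps inner_complex_def scaleR_conv_of_real)

end

global_interpretation complex_vector: vector_space "scaleC :: complex \<Rightarrow> 'a \<Rightarrow> 'a::complex_hilbert"
proof
  show "1 *\<^sub>C x = x" for x :: 'a
    using scaleC_of_real[of 1 x] by simp
qed (simp_all add: scaleC_add_right scaleC_add_left scaleC_scaleC)

definition orth_compl :: "'a::complex_hilbert set \<Rightarrow> 'a set"
  where "orth_compl S = {x. \<forall>y\<in>S. cinner x y = 0}"

text \<open>Only meaningful for closed subspaces \<open>L\<close>.\<close>

definition orth_proj :: "'a::complex_hilbert set \<Rightarrow> 'a \<Rightarrow> 'a"
  where "orth_proj L x = (THE y. y \<in> L \<and> x - y \<in> orth_compl L)"

text \<open>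
  An operator in \<open>H\<close> is a total function together with an explicit domain \<open>D\<close>;
  values outside \<open>D\<close> are irrelevant.
\<close>

definition linear_operator :: "'a::complex_hilbert set \<Rightarrow> ('a \<Rightarrow> 'a) \<Rightarrow> bool"
  where "linear_operator D A \<longleftrightarrow>
    complex_vector.subspace D \<and>
    (\<forall>x\<in>D. \<forall>y\<in>D. A (x + y) = A x + A y) \<and>
    (\<forall>c. \<forall>x\<in>D. A (c *\<^sub>C x) = c *\<^sub>C A x)"

definition bounded_operator :: "'a::complex_hilbert set \<Rightarrow> ('a \<Rightarrow> 'a) \<Rightarrow> bool"
  where "bounded_operator D A \<longleftrightarrow> linear_operator D A \<and> (\<exists>K. \<forall>x\<in>D. norm (A x) \<le> K * norm x)"

definition closed_isometric :: "'a::complex_hilbert set \<Rightarrow> ('a \<Rightarrow> 'a) \<Rightarrow> bool"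
  where "closed_isometric D V \<longleftrightarrow> linear_operator D V \<and> closed D \<and> (\<forall>x\<in>D. norm (V x) = norm x)"

definition regular_type :: "'a::complex_hilbert set \<Rightarrow> ('a \<Rightarrow> 'a) \<Rightarrow> complex \<Rightarrow> bool"
  where "regular_type D V z \<longleftrightarrow>
    (let A = (\<lambda>x. V x - z *\<^sub>C x) in inj_on A D \<and> bounded_operator (A ` D) (inv_into D A))"

definition M_space :: "'a::complex_hilbert set \<Rightarrow> ('a \<Rightarrow> 'a) \<Rightarrow> complex \<Rightarrow> 'a set"
  where "M_space D V z = (\<lambda>x. x - z *\<^sub>C V x) ` D"

definition N_space :: "'a::complex_hilbert set \<Rightarrow> ('a \<Rightarrow> 'a) \<Rightarrow> complex \<Rightarrow> 'a set"
  where "N_space D V z = orth_compl (M_space D V z)"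

definition M_inf :: "'a::complex_hilbert set \<Rightarrow> ('a \<Rightarrow> 'a) \<Rightarrow> 'a set"
  where "M_inf D V = V ` D"

definition N_inf :: "'a::complex_hilbert set \<Rightarrow> ('a \<Rightarrow> 'a) \<Rightarrow> 'a set"
  where "N_inf D V = orth_compl (M_inf D V)"

text \<open>The everywhere defined operator \<open>V \<oplus> C\<close> with respect to \<open>H = M\<^sub>0 \<oplus> N\<^sub>0\<close>, i.e. \<open>V\<^sup>+\<^sub>0\<^sub>;\<^sub>C\<close>.\<close>

definition V_plus :: "'a::complex_hilbert set \<Rightarrow> ('a \<Rightarrow> 'a) \<Rightarrow> ('a \<Rightarrow> 'a) \<Rightarrow> 'a \<Rightarrow> 'a"
  where "V_plus D V C x = V (orth_proj (M_space D V 0) x) + C (orth_proj (N_space D V 0) x)"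

text \<open>
  The domain of \<open>W\<^sub>z\<close> is the image of \<open>N_space D V z\<close> under \<open>orth_proj (N_space D V 0)\<close>.  For \<open>norm z = 1\<close>
  and \<open>V\<close> closed isometric, the value at a point of this domain does not depend on the choice of
  \<open>f\<close>, so the description is proper there; if moreover \<open>inverse z\<close> is a point of the regular type
  of \<open>V\<close>, the domain is the whole of \<open>N_space D V 0\<close>.
\<close>

definition W_op :: "'a::complex_hilbert set \<Rightarrow> ('a \<Rightarrow> 'a) \<Rightarrow> complex \<Rightarrow> 'a \<Rightarrow> 'a"
  where "W_op D V z g =
    (THE h. \<exists>f\<in>N_space D V z. g = orth_proj (N_space D V 0) f \<and>
                              h = inverse z *\<^sub>C orth_proj (N_inf D V) f)"

end

theory Submission
  imports Defs
begin

text \<open>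
  Write \<open>S d = d - \<zeta> V d\<close>, so that \<open>M\<^sub>\<zeta> = S D\<close>, and let \<open>U = V\<^sup>+\<^sub>0\<^sub>;\<^sub>C - \<zeta>\<^sup>-\<^sup>1 E\<close>.  Since \<open>\<zeta> V\<close> is
  isometric, expanding the norm gives, for every \<open>d \<in> D\<close>,
  \<open>\<parallel>S d\<parallel>\<^sup>2 = 2 Re \<langle>d, S d\<rangle> = - 2 Re \<langle>\<zeta> V d, S d\<rangle>\<close>.
  Hence an element \<open>S d\<close> of \<open>M\<^sub>\<zeta>\<close> vanishes as soon as it is orthogonal to \<open>d\<close> or to \<open>V d\<close>.
  Regularity says that \<open>S\<close> is bounded below, so that \<open>M\<^sub>\<zeta>\<close> is closed, and this identity then has three
  consequences:

  \<^item> \<open>H\<close> is the sum of \<open>D\<close> and \<open>N\<^sub>\<zeta>\<close> (\<open>domain_plus_N_space\<close>).  Indeed the projection onto \<open>M\<^sub>\<zeta>\<close> is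
    bounded below on \<open>D\<close>, so it maps \<open>D\<close> onto a closed subspace of \<open>M\<^sub>\<zeta>\<close>, and an element \<open>S e\<close> of
    \<open>M\<^sub>\<zeta>\<close> orthogonal to that image is in particular orthogonal to \<open>e\<close>.
  \<^item> \<open>D \<inter> N\<^sub>\<zeta> = {0}\<close>, so \<open>W\<^sub>\<zeta>\<close> is well defined (\<open>W_op_eq\<close>); by the previous item its domain is
    all of \<open>N\<^sub>0\<close> (\<open>domain_W_op\<close>).
  \<^item> \<open>M\<^sub>\<zeta> \<inter> N\<^sub>\<infinity> = {0}\<close> (\<open>M_space_inter_N_inf\<close>).

  Next, \<open>V P f = \<zeta>\<^sup>-\<^sup>1 Q f\<close> for \<open>f \<in> N\<^sub>\<zeta>\<close>, where \<open>P\<close> and \<open>Q\<close> project onto \<open>M\<^sub>0\<close> and \<open>M\<^sub>\<infinity>\<close>; thus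
  \<open>V \<oplus> W\<^sub>\<zeta>\<close> acts on \<open>N\<^sub>\<zeta>\<close> as multiplication by \<open>\<zeta>\<^sup>-\<^sup>1\<close>.  Decomposing \<open>x = d + f\<close> with \<open>d \<in> D\<close> and
  \<open>f \<in> N\<^sub>\<zeta>\<close>, the operator \<open>U\<close> sends \<open>x\<close> to \<open>(V d - \<zeta>\<^sup>-\<^sup>1 d) + (C - W\<^sub>\<zeta>) g\<close>, where \<open>g\<close> is the
  projection of \<open>f\<close> to \<open>N\<^sub>0\<close>.  Therefore \<open>R(U) = M\<^sub>\<zeta> + (C - W\<^sub>\<zeta>) N\<^sub>0\<close> (\<open>range_V_plus\<close>).  As the
  second summand lies in \<open>N\<^sub>\<infinity>\<close>, which meets \<open>M\<^sub>\<zeta>\<close> only in \<open>0\<close>, this sum is all of \<open>H\<close> exactly when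
  the second summand fills \<open>N\<^sub>\<infinity>\<close> and \<open>M\<^sub>\<zeta>\<close> projects onto \<open>M\<^sub>\<infinity>\<close>.
\<close>

section \<open>Complex inner products\<close>

lemma cinner_add_right: "cinner x (y + z) = cinner x y + cinner x z"
  by (metis cinner_add_left cinner_commute complex_cnj_add)

lemma cinner_scaleC_right: "cinner x (a *\<^sub>C y) = cnj a * cinner x y"
  by (metis cinner_scaleC_left cinner_commute complex_cnj_mult)

lemma cinner_diff_left: "cinner (x - y) z = cinner x z - cinner y z"
  by (metis add_diff_cancel cinner_add_left diff_add_cancel)

lemma cinner_diff_right: "cinner x (y - z) = cinner x y - cinner x z"
  by (metis add_diff_cancel cinner_add_right diff_add_cancel)

lemma cinner_self_eq_0: "cinner x x = 0 \<Longrightarrow> x = 0"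
  by (metis Re_cinner inner_eq_zero_iff zero_complex.sel(1))

lemma cinner_eq_0_sym: "cinner x y = 0 \<longleftrightarrow> cinner y x = 0"
  by (metis cinner_commute complex_cnj_zero_iff)

lemma cinner_zero_left [simp]: "cinner 0 y = 0"
  using cinner_add_left[of 0 0 y] by simp

lemma norm_scaleC: "norm (a *\<^sub>C x) = cmod a * norm x"
proof (rule power2_eq_imp_eq)
  have "(norm (a *\<^sub>C x))\<^sup>2 = Re (cinner (a *\<^sub>C x) (a *\<^sub>C x))"
    by (simp add: Re_cinner power2_norm_eq_inner)
  also have "cinner (a *\<^sub>C x) (a *\<^sub>C x) = complex_of_real ((cmod a)\<^sup>2) * cinner x x"
    by (simp add: cinner_scaleC_left cinner_scaleC_right complex_norm_square mult_ac
        del: of_real_power)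
  also have "Re \<dots> = (cmod a * norm x)\<^sup>2"
    by (simp add: Re_cinner power2_norm_eq_inner power_mult_distrib del: of_real_power)
  finally show "(norm (a *\<^sub>C x))\<^sup>2 = (cmod a * norm x)\<^sup>2" .
qed auto

section \<open>Orthogonal projections\<close>

text \<open>A complex subspace is closed under multiplication by \<open>\<i>\<close>, which turns real parts of inner
  products into imaginary parts.\<close>

lemma orth_compl_real:
  assumes L: "complex_vector.subspace L" and r: "\<And>w. w \<in> L \<Longrightarrow> inner x w = 0"
  shows "x \<in> orth_compl L"
proof -
  have "cinner x w = 0" if w: "w \<in> L" for w
  proof (rule complex_eqI)
    show "Re (cinner x w) = Re 0"
      using r[OF w] by (simp add: Re_cinner)
    have "Re (cinner x (\<i> *\<^sub>C w)) = 0"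
      using r[of "\<i> *\<^sub>C w"] complex_vector.subspace_scale[OF L w] by (simp add: Re_cinner)
    then show "Im (cinner x w) = Im 0"
      by (simp add: cinner_scaleC_right)
  qed
  then show ?thesis by (simp add: orth_compl_def)
qed

lemma subspace_orth_compl: "complex_vector.subspace (orth_compl L)"
  by (rule complex_vector.subspaceI)
    (auto simp: orth_compl_def cinner_add_left cinner_scaleC_left)

text \<open>A minimizing sequence for the distance to a closed subspace is Cauchy by the parallelogram law,
  because midpoints stay in the subspace.\<close>

lemma closest_point_subspace:
  fixes L :: "'a::complex_hilbert set"
  assumes L: "complex_vector.subspace L" and cl: "closed L"
  shows "\<exists>y\<in>L. \<forall>w\<in>L. norm (x - y) \<le> norm (x - w)"
proof -
  define \<delta> where "\<delta> = infdist x L"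
  have ne: "L \<noteq> {}" using complex_vector.subspace_0[OF L] by auto
  have low: "\<delta> \<le> norm (x - w)" if "w \<in> L" for w
    using infdist_le[OF that, of x] by (simp add: \<delta>_def dist_norm)
  have d0: "0 \<le> \<delta>" by (simp add: \<delta>_def infdist_nonneg)
  have "\<exists>w\<in>L. norm (x - w) < \<delta> + 1 / real (Suc n)" for n
  proof -
    have "(INF a\<in>L. dist x a) < \<delta> + 1 / real (Suc n)"
      using ne by (simp add: \<delta>_def infdist_def)
    moreover have "bdd_below (dist x ` L)"
      by (rule bdd_belowI2[where m = 0]) simp
    ultimately show ?thesis
      using cINF_less_iff[OF ne] by (metis dist_norm)
  qed
  then obtain Y where YL: "\<And>n. Y n \<in> L"
    and Y: "\<And>n. norm (x - Y n) < \<delta> + 1 / real (Suc n)"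
    by metis
  have lim: "(\<lambda>n. norm (x - Y n)) \<longlonglongrightarrow> \<delta>"
  proof (rule real_tendsto_sandwich[OF _ _ tendsto_const])
    show "(\<lambda>n. \<delta> + 1 / real (Suc n)) \<longlonglongrightarrow> \<delta>"
      using tendsto_add[OF tendsto_const LIMSEQ_inverse_real_of_nat, of \<delta>]
      by (simp add: inverse_eq_divide)
    show "\<forall>\<^sub>F n in sequentially. \<delta> \<le> norm (x - Y n)"
      using low YL by (intro always_eventually) blast
    show "\<forall>\<^sub>F n in sequentially. norm (x - Y n) \<le> \<delta> + 1 / real (Suc n)"
      using Y by (intro always_eventually) (blast intro: less_imp_le)
  qed
  have par: "(norm (Y m - Y n))\<^sup>2 \<le> 2 * ((norm (x - Y m))\<^sup>2 - \<delta>\<^sup>2) + 2 * ((norm (x - Y n))\<^sup>2 - \<delta>\<^sup>2)"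
    for m n
  proof -
    let ?w = "(1/2::real) *\<^sub>R (Y m + Y n)"
    have "?w \<in> L"
      using complex_vector.subspace_scale[OF L complex_vector.subspace_add[OF L YL YL],
          of "complex_of_real (1/2)" m n]
      by (simp only: scaleC_of_real)
    then have "\<delta>\<^sup>2 \<le> (norm (x - ?w))\<^sup>2"
      using low d0 by (intro power_mono) auto
    moreover have "4 * (norm (x - ?w))\<^sup>2 + (norm (Y m - Y n))\<^sup>2
        = 2 * (norm (x - Y m))\<^sup>2 + 2 * (norm (x - Y n))\<^sup>2"
      by (simp add: power2_norm_eq_inner algebra_simps inner_commute)
    ultimately show ?thesis by (simp add: algebra_simps)
  qed
  have "Cauchy Y"
  proof (rule metric_CauchyI)
    fix e :: real assume e: "0 < e"
    have "(\<lambda>n. (norm (x - Y n))\<^sup>2 - \<delta>\<^sup>2) \<longlonglongrightarrow> \<delta>\<^sup>2 - \<delta>\<^sup>2"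
      by (intro tendsto_intros lim)
    then have "\<forall>\<^sub>F n in sequentially. (norm (x - Y n))\<^sup>2 - \<delta>\<^sup>2 < e\<^sup>2 / 4"
      using e by (intro order_tendstoD(2)) auto
    then obtain N where N: "\<And>n. n \<ge> N \<Longrightarrow> (norm (x - Y n))\<^sup>2 - \<delta>\<^sup>2 < e\<^sup>2 / 4"
      by (auto simp: eventually_sequentially)
    have "dist (Y m) (Y n) < e" if "m \<ge> N" "n \<ge> N" for m n
    proof -
      have "(norm (Y m - Y n))\<^sup>2 < e\<^sup>2"
        using par[of m n] N[OF that(1)] N[OF that(2)] by argo
      then show ?thesis
        using e by (simp add: dist_norm power_less_imp_less_base)
    qed
    then show "\<exists>M. \<forall>m\<ge>M. \<forall>n\<ge>M. dist (Y m) (Y n) < e" by blast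
  qed
  then obtain y where y: "Y \<longlonglongrightarrow> y"
    using Cauchy_convergent convergent_def by blast
  have "y \<in> L"
    using closed_sequentially[OF cl _ y] YL by blast
  moreover have "norm (x - y) = \<delta>"
    by (rule LIMSEQ_unique[OF tendsto_norm[OF tendsto_diff[OF tendsto_const y]] lim])
  ultimately show ?thesis using low by auto
qed

lemma projection_exists:
  fixes L :: "'a::complex_hilbert set"
  assumes L: "complex_vector.subspace L" and cl: "closed L"
  shows "\<exists>y\<in>L. x - y \<in> orth_compl L"
proof -
  obtain y where y: "y \<in> L" and m: "\<And>w. w \<in> L \<Longrightarrow> norm (x - y) \<le> norm (x - w)"
    using closest_point_subspace[OF L cl] by blast
  have "inner (x - y) w = 0" if w: "w \<in> L" for w
  proof (rule ccontr)
    assume nz: "inner (x - y) w \<noteq> 0"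
    then have w0: "inner w w > 0" by auto
    \<comment> \<open>Moving from \<open>y\<close> by the component of \<open>x - y\<close> along \<open>w\<close> would decrease the distance.\<close>
    define t where "t = inner (x - y) w / inner w w"
    have "t *\<^sub>R w \<in> L"
      using complex_vector.subspace_scale[OF L w, of "complex_of_real t"] by (simp add: scaleC_of_real)
    then have "norm (x - y) \<le> norm (x - (y + t *\<^sub>R w))"
      using m complex_vector.subspace_add[OF L y] by blast
    then have "(norm (x - y))\<^sup>2 \<le> (norm ((x - y) - t *\<^sub>R w))\<^sup>2"
      by (simp add: diff_diff_eq)
    also have "\<dots> = (norm (x - y))\<^sup>2 - 2 * t * inner (x - y) w + t\<^sup>2 * inner w w"
      unfolding power2_norm_eq_inner
      by (simp add: inner_diff_left inner_diff_right inner_commute power2_eq_square right_diff_distrib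
          left_diff_distrib)
    also have "\<dots> = (norm (x - y))\<^sup>2 - (inner (x - y) w)\<^sup>2 / inner w w"
      using w0 by (simp add: t_def power2_eq_square)
    finally show False using nz w0 by (simp add: divide_le_0_iff)
  qed
  then show ?thesis
    using y orth_compl_real[OF L] by blast
qed

text \<open>Uniqueness needs only that a subspace meets its orthogonal complement in \<open>0\<close>.\<close>

lemma orth_proj_eqI:
  assumes L: "complex_vector.subspace L" and y: "y \<in> L" and o: "x - y \<in> orth_compl L"
  shows "orth_proj L x = y"
  unfolding orth_proj_def
proof (rule the_equality)
  show "y \<in> L \<and> x - y \<in> orth_compl L" using y o by blast
  fix w assume w: "w \<in> L \<and> x - w \<in> orth_compl L"
  have "w - y \<in> L" using complex_vector.subspace_diff[OF L] w y by blast
  moreover have "w - y \<in> orth_compl L"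
    using complex_vector.subspace_diff[OF subspace_orth_compl o, of "x - w"] w by simp
  ultimately have "cinner (w - y) (w - y) = 0" by (simp add: orth_compl_def)
  then show "w = y" using cinner_self_eq_0 by fastforce
qed

locale closed_subspace =
  fixes L :: "'a::complex_hilbert set"
  assumes subspace: "complex_vector.subspace L" and closed: "closed L"
begin

lemma proj_mem: "orth_proj L x \<in> L"
  and proj_residual: "x - orth_proj L x \<in> orth_compl L"
  using projection_exists[OF subspace closed, of x] orth_proj_eqI[OF subspace] by metis+

lemma proj_add: "orth_proj L (x + y) = orth_proj L x + orth_proj L y"
proof (rule orth_proj_eqI[OF subspace])
  show "orth_proj L x + orth_proj L y \<in> L"
    by (rule complex_vector.subspace_add[OF subspace proj_mem proj_mem])
  show "x + y - (orth_proj L x + orth_proj L y) \<in> orth_compl L"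
    using complex_vector.subspace_add[OF subspace_orth_compl proj_residual proj_residual, of x y]
    by (simp add: algebra_simps)
qed

lemma proj_scaleC: "orth_proj L (a *\<^sub>C x) = a *\<^sub>C orth_proj L x"
proof (rule orth_proj_eqI[OF subspace])
  show "a *\<^sub>C orth_proj L x \<in> L"
    by (rule complex_vector.subspace_scale[OF subspace proj_mem])
  show "a *\<^sub>C x - a *\<^sub>C orth_proj L x \<in> orth_compl L"
    using complex_vector.subspace_scale[OF subspace_orth_compl proj_residual, of a x]
    by (simp add: complex_vector.scale_right_diff_distrib)
qed

lemma proj_diff: "orth_proj L (x - y) = orth_proj L x - orth_proj L y"
  using proj_add[of "x - y" y] by (simp add: algebra_simps)

lemma proj_fixed: "x \<in> L \<Longrightarrow> orth_proj L x = x"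
  by (rule orth_proj_eqI[OF subspace]) (simp_all add: complex_vector.subspace_0[OF subspace_orth_compl])

lemma proj_orth_compl: "x \<in> orth_compl L \<Longrightarrow> orth_proj L x = 0"
  by (rule orth_proj_eqI[OF subspace]) (simp_all add: complex_vector.subspace_0[OF subspace])

lemma proj_complement: "orth_proj (orth_compl L) x = x - orth_proj L x"
proof (rule orth_proj_eqI[OF subspace_orth_compl proj_residual])
  show "x - (x - orth_proj L x) \<in> orth_compl (orth_compl L)"
    using proj_mem[of x] cinner_eq_0_sym by (fastforce simp: orth_compl_def)
qed

lemma cinner_proj: "w \<in> L \<Longrightarrow> cinner (orth_proj L x) w = cinner x w"
  using proj_residual[of x] by (auto simp: orth_compl_def cinner_diff_left)

lemma norm_proj_le: "norm (orth_proj L x) \<le> norm x"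
proof (rule power2_le_imp_le)
  have "inner (orth_proj L x) (x - orth_proj L x) = 0"
    using proj_residual[of x] proj_mem[of x]
    by (metis (mono_tags, lifting) Re_cinner cinner_eq_0_sym mem_Collect_eq orth_compl_def zero_complex.sel(1))
  then have "(norm x)\<^sup>2 = (norm (orth_proj L x))\<^sup>2 + (norm (x - orth_proj L x))\<^sup>2"
    by (simp add: power2_norm_eq_inner algebra_simps inner_commute)
  then show "(norm (orth_proj L x))\<^sup>2 \<le> (norm x)\<^sup>2" by simp
qed simp

end

section \<open>Images under operators bounded below\<close>

lemma linear_operator_diff:
  assumes "linear_operator D A" "x \<in> D" "y \<in> D"
  shows "A (x - y) = A x - A y"
proof -
  have "x - y \<in> D" using assms complex_vector.subspace_diff by (auto simp: linear_operator_def)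
  then have "A (x - y + y) = A (x - y) + A y"
    using assms unfolding linear_operator_def by blast
  then show ?thesis by simp
qed

lemma linear_operator_image_subspace:
  assumes A: "linear_operator D A"
  shows "complex_vector.subspace (A ` D)"
proof (rule complex_vector.subspaceI)
  have D: "complex_vector.subspace D" using A by (simp add: linear_operator_def)
  have "A 0 = 0" using linear_operator_diff[OF A, of 0 0] complex_vector.subspace_0[OF D] by simp
  then show "0 \<in> A ` D" using complex_vector.subspace_0[OF D] by force
  show "x + y \<in> A ` D" if xy: "x \<in> A ` D" "y \<in> A ` D" for x y
  proof -
    obtain u v where "u \<in> D" "v \<in> D" "x = A u" "y = A v" using xy by blast
    then have "x + y = A (u + v)" "u + v \<in> D"
      using A complex_vector.subspace_add[OF D] by (auto simp: linear_operator_def)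
    then show ?thesis by blast
  qed
  show "a *\<^sub>C x \<in> A ` D" if x: "x \<in> A ` D" for a x
  proof -
    obtain u where "u \<in> D" "x = A u" using x by blast
    then have "a *\<^sub>C x = A (a *\<^sub>C u)" "a *\<^sub>C u \<in> D"
      using A complex_vector.subspace_scale[OF D] by (auto simp: linear_operator_def)
    then show ?thesis by blast
  qed
qed

text \<open>The lower bound lifts a convergent sequence of values to a Cauchy sequence of arguments.\<close>

lemma closed_image_bounded_below:
  fixes A :: "'a::complex_hilbert \<Rightarrow> 'a"
  assumes A: "linear_operator D A" and D: "closed D" and c: "c > 0"
    and low: "\<And>x. x \<in> D \<Longrightarrow> c * norm x \<le> norm (A x)"
    and up: "\<And>x. x \<in> D \<Longrightarrow> norm (A x) \<le> K * norm x"
  shows "closed (A ` D)"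
  unfolding closed_sequential_limits
proof (intro allI impI, elim conjE)
  fix Y y assume "\<forall>n. Y n \<in> A ` D" and lim: "Y \<longlonglongrightarrow> y"
  then have "\<forall>n. \<exists>x. x \<in> D \<and> Y n = A x" by blast
  then obtain X where X: "\<And>n. X n \<in> D" and Y: "\<And>n. Y n = A (X n)" by metis
  have dD: "u - v \<in> D" if "u \<in> D" "v \<in> D" for u v
    using complex_vector.subspace_diff that A by (auto simp: linear_operator_def)
  have "Cauchy X"
  proof (rule metric_CauchyI)
    fix e :: real assume e: "0 < e"
    obtain N where N: "\<And>m n. m \<ge> N \<Longrightarrow> n \<ge> N \<Longrightarrow> dist (Y m) (Y n) < c * e"
      using metric_CauchyD[OF LIMSEQ_imp_Cauchy[OF lim], of "c * e"] c e by auto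
    have "dist (X m) (X n) < e" if "m \<ge> N" "n \<ge> N" for m n
    proof -
      have "c * norm (X m - X n) \<le> norm (A (X m - X n))"
        using low dD X by blast
      also have "\<dots> = dist (Y m) (Y n)"
        using linear_operator_diff[OF A X X] by (simp add: dist_norm Y)
      also have "\<dots> < c * e" using N that by blast
      finally show ?thesis using c by (simp add: dist_norm)
    qed
    then show "\<exists>M. \<forall>m\<ge>M. \<forall>n\<ge>M. dist (X m) (X n) < e" by blast
  qed
  then obtain x where x: "X \<longlonglongrightarrow> x"
    using Cauchy_convergent convergent_def by blast
  have xD: "x \<in> D" using closed_sequentially[OF D _ x] X by blast
  have "Y \<longlonglongrightarrow> A x"
  proof (rule Lim_transform_bound[THEN LIM_zero_cancel])
    show "\<forall>\<^sub>F n in sequentially. norm (Y n - A x) \<le> norm (K * norm (X n - x))"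
    proof (rule always_eventually, rule allI)
      fix n
      have "norm (Y n - A x) = norm (A (X n - x))"
        using linear_operator_diff[OF A X xD] by (simp add: Y)
      also have "\<dots> \<le> K * norm (X n - x)" using up dD X xD by blast
      finally show "norm (Y n - A x) \<le> norm (K * norm (X n - x))" by simp
    qed
    show "(\<lambda>n. K * norm (X n - x)) \<longlonglongrightarrow> 0"
      by (intro tendsto_mult_right_zero tendsto_norm_zero LIM_zero x)
  qed
  then have "y = A x" using LIMSEQ_unique lim by blast
  then show "y \<in> A ` D" using xD by blast
qed

section \<open>Isometric operators at a regular point of the unit circle\<close>

text \<open>The point \<open>\<zeta>\<^sup>-\<^sup>1\<close> enters through the lower bound \<open>k\<close> for \<open>E - \<zeta> V = - \<zeta> (V - \<zeta>\<^sup>-\<^sup>1 E)\<close>.\<close>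

locale regular_isometry =
  fixes D :: "'a::complex_hilbert set" and V :: "'a \<Rightarrow> 'a" and \<zeta> :: complex and k :: real
  assumes isometric: "closed_isometric D V"
    and unit: "cmod \<zeta> = 1"
    and k_pos: "k > 0"
    and bounded_below: "\<And>d. d \<in> D \<Longrightarrow> k * norm d \<le> norm (d - \<zeta> *\<^sub>C V d)"
begin

definition S :: "'a \<Rightarrow> 'a"
  where "S d = d - \<zeta> *\<^sub>C V d"

lemma V_linear: "linear_operator D V"
  and D_closed: "closed D"
  and V_norm: "d \<in> D \<Longrightarrow> norm (V d) = norm d"
  using isometric by (auto simp: closed_isometric_def)

lemma D_subspace: "complex_vector.subspace D"
  using V_linear by (simp add: linear_operator_def)

lemma V_add: "x \<in> D \<Longrightarrow> y \<in> D \<Longrightarrow> V (x + y) = V x + V y"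
  and V_scaleC: "x \<in> D \<Longrightarrow> V (a *\<^sub>C x) = a *\<^sub>C V x"
  using V_linear by (auto simp: linear_operator_def)

lemma M_space_eq: "M_space D V \<zeta> = S ` D"
  by (simp add: M_space_def S_def)

lemma S_linear: "linear_operator D S"
  unfolding linear_operator_def S_def
  by (auto simp: D_subspace V_add V_scaleC complex_vector.scale_right_distrib
      complex_vector.scale_right_diff_distrib complex_vector.scale_left_commute)

lemma norm_S_le: "d \<in> D \<Longrightarrow> norm (S d) \<le> 2 * norm d"
  using norm_triangle_ineq4[of d "\<zeta> *\<^sub>C V d"] by (simp add: S_def norm_scaleC unit V_norm)

sublocale D: closed_subspace D
  by unfold_locales (rule D_subspace, rule D_closed)

sublocale Mz: closed_subspace "M_space D V \<zeta>"
proof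
  show "complex_vector.subspace (M_space D V \<zeta>)"
    unfolding M_space_eq by (rule linear_operator_image_subspace[OF S_linear])
  show "closed (M_space D V \<zeta>)"
    unfolding M_space_eq
    by (rule closed_image_bounded_below[OF S_linear D_closed k_pos])
      (use bounded_below norm_S_le in \<open>auto simp: S_def\<close>)
qed

sublocale Mi: closed_subspace "M_inf D V"
proof
  show "complex_vector.subspace (M_inf D V)"
    unfolding M_inf_def by (rule linear_operator_image_subspace[OF V_linear])
  show "closed (M_inf D V)"
    unfolding M_inf_def
    by (rule closed_image_bounded_below[OF V_linear D_closed, of 1 1]) (auto simp: V_norm)
qed

lemma M_space_0: "M_space D V 0 = D"
  by (simp add: M_space_def)

lemma N_space_0: "N_space D V 0 = orth_compl D"
  by (simp add: N_space_def M_space_0)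

lemma S_eq_0: "d \<in> D \<Longrightarrow> S d = 0 \<Longrightarrow> d = 0"
  using bounded_below[of d] k_pos by (simp add: S_def mult_le_0_iff)

text \<open>Both identities expand the norm of \<open>d - \<zeta> V d\<close> and use \<open>\<parallel>\<zeta> V d\<parallel> = \<parallel>d\<parallel>\<close>.\<close>

lemma norm_S_sq:
  assumes "d \<in> D"
  shows "(norm (S d))\<^sup>2 = 2 * inner d (S d)"
    and "(norm (S d))\<^sup>2 = - 2 * inner (\<zeta> *\<^sub>C V d) (S d)"
proof -
  have "(norm (\<zeta> *\<^sub>C V d))\<^sup>2 = (norm d)\<^sup>2"
    by (simp add: norm_scaleC unit V_norm[OF assms])
  then have e: "inner (\<zeta> *\<^sub>C V d) (\<zeta> *\<^sub>C V d) = inner d d"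
    by (simp add: power2_norm_eq_inner)
  show "(norm (S d))\<^sup>2 = 2 * inner d (S d)" "(norm (S d))\<^sup>2 = - 2 * inner (\<zeta> *\<^sub>C V d) (S d)"
    unfolding power2_norm_eq_inner S_def
    by (simp_all add: inner_diff_left inner_diff_right e inner_commute)
qed

lemma S_eq_0_if_orthogonal:
  assumes "d \<in> D" and "cinner d (S d) = 0 \<or> cinner (V d) (S d) = 0"
  shows "S d = 0"
proof -
  from assms(2) have "inner d (S d) = 0 \<or> inner (\<zeta> *\<^sub>C V d) (S d) = 0"
    by (auto simp: cinner_scaleC_left simp flip: Re_cinner)
  then show ?thesis using norm_S_sq[OF assms(1)] by auto
qed

lemma domain_inter_N_space: "u \<in> D \<Longrightarrow> u \<in> N_space D V \<zeta> \<Longrightarrow> u = 0"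
  using S_eq_0 S_eq_0_if_orthogonal by (auto simp: N_space_def M_space_eq orth_compl_def)

lemma M_space_inter_N_inf:
  assumes "m \<in> M_space D V \<zeta>" "m \<in> N_inf D V"
  shows "m = 0"
proof -
  obtain d where d: "d \<in> D" "m = S d" using assms(1) by (auto simp: M_space_eq)
  then have "cinner (S d) (V d) = 0"
    using assms(2) by (auto simp: N_inf_def M_inf_def orth_compl_def)
  then show ?thesis using S_eq_0_if_orthogonal[OF d(1)] cinner_eq_0_sym d by blast
qed

text \<open>Since \<open>S d\<close> lies in \<open>M\<^sub>\<zeta>\<close>, its inner products with \<open>d\<close> and with the projection of \<open>d\<close>
  agree.  The real part of the former is \<open>\<parallel>S d\<parallel>\<^sup>2 / 2\<close>, so by Cauchy-Schwarz the projection has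
  norm at least \<open>\<parallel>S d\<parallel> / 2\<close>.\<close>

lemma proj_M_space_bounded_below:
  assumes d: "d \<in> D"
  shows "k / 2 * norm d \<le> norm (orth_proj (M_space D V \<zeta>) d)"
proof (cases "S d = 0")
  case True
  then show ?thesis using S_eq_0[OF d] by simp
next
  case False
  let ?p = "orth_proj (M_space D V \<zeta>) d"
  have "inner d (S d) = inner ?p (S d)"
    using Mz.cinner_proj[of "S d" d] d by (simp add: M_space_eq flip: Re_cinner)
  then have "(norm (S d))\<^sup>2 \<le> 2 * (norm ?p * norm (S d))"
    using norm_S_sq(1)[OF d] norm_cauchy_schwarz[of ?p "S d"] by simp
  then have "norm (S d) * norm (S d) \<le> (2 * norm ?p) * norm (S d)"
    by (simp add: power2_eq_square mult.assoc)
  then have "norm (S d) \<le> 2 * norm ?p"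
    using False by simp
  then show ?thesis using bounded_below[OF d] by (simp add: S_def)
qed

lemma proj_M_space_onto: "orth_proj (M_space D V \<zeta>) ` D = M_space D V \<zeta>"
proof
  let ?P = "orth_proj (M_space D V \<zeta>)"
  show "?P ` D \<subseteq> M_space D V \<zeta>" using Mz.proj_mem by blast
  show "M_space D V \<zeta> \<subseteq> ?P ` D"
  proof
    fix h assume h: "h \<in> M_space D V \<zeta>"
    have lin: "linear_operator D ?P"
      by (simp add: linear_operator_def D_subspace Mz.proj_add Mz.proj_scaleC)
    have cl: "closed (?P ` D)"
      by (rule closed_image_bounded_below[OF lin D_closed, of "k / 2" 1])
        (use proj_M_space_bounded_below k_pos Mz.norm_proj_le in auto)
    obtain p where p: "p \<in> ?P ` D" and o: "h - p \<in> orth_compl (?P ` D)"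
      using projection_exists[OF linear_operator_image_subspace[OF lin] cl] by blast
    have "h - p \<in> M_space D V \<zeta>"
      using complex_vector.subspace_diff[OF Mz.subspace h] p Mz.proj_mem by blast
    then obtain e where e: "e \<in> D" "h - p = S e" by (auto simp: M_space_eq)
    have "cinner (?P e) (S e) = 0"
      using o e cinner_eq_0_sym by (fastforce simp: orth_compl_def)
    then have "cinner e (S e) = 0"
      using Mz.cinner_proj[of "S e" e] e by (simp add: M_space_eq)
    then have "h = p" using S_eq_0_if_orthogonal[OF e(1)] e(2) by simp
    then show "h \<in> ?P ` D" using p by simp
  qed
qed

lemma domain_plus_N_space:
  obtains d f where "d \<in> D" "f \<in> N_space D V \<zeta>" "x = d + f"
proof -
  let ?P = "orth_proj (M_space D V \<zeta>)"
  have "?P x \<in> ?P ` D" using proj_M_space_onto Mz.proj_mem by blast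
  then obtain d where d: "d \<in> D" "?P x = ?P d" by blast
  then have "x - d \<in> N_space D V \<zeta>"
    using Mz.proj_residual[of "x - d"] by (simp add: Mz.proj_diff N_space_def)
  then show ?thesis using that[of d "x - d"] d by simp
qed

section \<open>The operator \<open>W\<^sub>\<zeta>\<close>\<close>

lemma domain_W_op: "orth_proj (N_space D V 0) ` N_space D V \<zeta> = N_space D V 0"
proof
  let ?P = "orth_proj (N_space D V 0)"
  show "?P ` N_space D V \<zeta> \<subseteq> N_space D V 0"
    by (auto simp: N_space_0 D.proj_complement D.proj_residual)
  show "N_space D V 0 \<subseteq> ?P ` N_space D V \<zeta>"
  proof
    fix g assume g: "g \<in> N_space D V 0"
    obtain d f where df: "d \<in> D" "f \<in> N_space D V \<zeta>" "g = d + f" by (rule domain_plus_N_space)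
    have "g - orth_proj D g = ?P f"
      by (simp add: df(3) N_space_0 D.proj_complement D.proj_add D.proj_fixed[OF df(1)])
    then have "g = ?P f"
      using g by (simp add: N_space_0 D.proj_orth_compl)
    then show "g \<in> ?P ` N_space D V \<zeta>" using df(2) by blast
  qed
qed

lemma W_op_eq:
  assumes f: "f \<in> N_space D V \<zeta>"
  shows "W_op D V \<zeta> (orth_proj (N_space D V 0) f) = inverse \<zeta> *\<^sub>C orth_proj (N_inf D V) f"
  unfolding W_op_def
proof (rule the_equality)
  fix h assume "\<exists>f'\<in>N_space D V \<zeta>. orth_proj (N_space D V 0) f = orth_proj (N_space D V 0) f' \<and>
      h = inverse \<zeta> *\<^sub>C orth_proj (N_inf D V) f'"
  then obtain f' where f': "f' \<in> N_space D V \<zeta>"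
    and eq: "orth_proj (N_space D V 0) f = orth_proj (N_space D V 0) f'"
    and h: "h = inverse \<zeta> *\<^sub>C orth_proj (N_inf D V) f'" by blast
  have "f - f' = orth_proj D f - orth_proj D f'"
    using eq by (simp add: N_space_0 D.proj_complement algebra_simps)
  then have "f - f' \<in> D"
    using complex_vector.subspace_diff[OF D_subspace] D.proj_mem by metis
  moreover have "f - f' \<in> N_space D V \<zeta>"
    using complex_vector.subspace_diff[OF subspace_orth_compl] f f' by (simp add: N_space_def)
  ultimately have "f - f' = 0" by (rule domain_inter_N_space)
  then show "h = inverse \<zeta> *\<^sub>C orth_proj (N_inf D V) f" using h by simp
qed (use f in blast)

text \<open>Against \<open>V e\<close>, the two sides are \<open>\<langle>f, e\<rangle>\<close> and \<open>\<langle>f, \<zeta> V e\<rangle>\<close>, which agree because \<open>f\<close> is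
  orthogonal to \<open>S e\<close>.\<close>

lemma V_proj_domain:
  assumes f: "f \<in> N_space D V \<zeta>"
  shows "V (orth_proj D f) = inverse \<zeta> *\<^sub>C orth_proj (M_inf D V) f"
proof -
  let ?u = "V (orth_proj D f) - inverse \<zeta> *\<^sub>C orth_proj (M_inf D V) f"
  have inv: "inverse \<zeta> = cnj \<zeta>"
    using unit by (metis complex_norm_square inverse_unique of_real_1 power_one)
  have inner_V: "inner (V a) (V b) = inner a b" if "a \<in> D" "b \<in> D" for a b
  proof -
    have "(norm (V (a + b)))\<^sup>2 = (norm (a + b))\<^sup>2" "(norm (V a))\<^sup>2 = (norm a)\<^sup>2" "(norm (V b))\<^sup>2 = (norm b)\<^sup>2"
      using that complex_vector.subspace_add[OF D_subspace that] by (simp_all add: V_norm)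
    then show ?thesis
      using that by (simp add: V_add power2_norm_eq_inner inner_add_left inner_add_right inner_commute)
  qed
  have uM: "?u \<in> M_inf D V"
    using D.proj_mem[of f] Mi.proj_mem[of f]
    by (intro complex_vector.subspace_diff[OF Mi.subspace] complex_vector.subspace_scale[OF Mi.subspace])
      (auto simp: M_inf_def)
  then obtain e where e: "e \<in> D" "?u = V e" by (auto simp: M_inf_def)
  have "cinner f (S e) = 0"
    using f e by (auto simp: N_space_def M_space_eq orth_compl_def)
  then have fe: "cinner f e = inverse \<zeta> * cinner f (V e)"
    by (simp add: S_def cinner_diff_right cinner_scaleC_right inv)
  have "inner (V (orth_proj D f)) (V e) = Re (cinner f e)"
    using inner_V[OF D.proj_mem e(1)] D.cinner_proj[OF e(1)] by (simp flip: Re_cinner)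
  moreover have "cinner (orth_proj (M_inf D V) f) (V e) = cinner f (V e)"
    using e by (intro Mi.cinner_proj) (auto simp: M_inf_def)
  then have "inner (inverse \<zeta> *\<^sub>C orth_proj (M_inf D V) f) (V e) = Re (inverse \<zeta> * cinner f (V e))"
    by (simp add: cinner_scaleC_left flip: Re_cinner)
  ultimately have "inner ?u (V e) = 0"
    using fe by (simp add: inner_diff_left)
  then have "inner ?u ?u = 0" using e(2) by simp
  then show ?thesis by simp
qed

section \<open>The range of \<open>V \<oplus> C - \<zeta>\<^sup>-\<^sup>1 E\<close>\<close>

text \<open>The terms of \<open>\<zeta>\<^sup>-\<^sup>1 f\<close> in \<open>M\<^sub>\<infinity>\<close> cancel against \<open>V\<close> applied to the projection of \<open>f\<close> to
  \<open>D\<close>, and the terms in \<open>N\<^sub>\<infinity>\<close> are by definition \<open>W\<^sub>\<zeta> g\<close>.\<close>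

lemma V_plus_decomposed:
  assumes d: "d \<in> D" and f: "f \<in> N_space D V \<zeta>"
  defines "g \<equiv> orth_proj (N_space D V 0) f"
  shows "V_plus D V C (d + f) - inverse \<zeta> *\<^sub>C (d + f)
    = S (- inverse \<zeta> *\<^sub>C d) + (C g - W_op D V \<zeta> g)"
proof -
  have \<zeta>: "\<zeta> \<noteq> 0" using unit by auto
  have "orth_proj (N_space D V 0) (d + f) = g"
    by (simp add: g_def N_space_0 D.proj_complement D.proj_add D.proj_fixed[OF d])
  then have "V_plus D V C (d + f) = V (d + orth_proj D f) + C g"
    by (simp add: V_plus_def M_space_0 D.proj_add D.proj_fixed[OF d])
  also have "\<dots> = V d + inverse \<zeta> *\<^sub>C orth_proj (M_inf D V) f + C g"
    by (simp add: V_add[OF d D.proj_mem] V_proj_domain[OF f])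
  finally have 1: "V_plus D V C (d + f) = V d + inverse \<zeta> *\<^sub>C orth_proj (M_inf D V) f + C g" .
  have 2: "W_op D V \<zeta> g = inverse \<zeta> *\<^sub>C f - inverse \<zeta> *\<^sub>C orth_proj (M_inf D V) f"
    unfolding g_def W_op_eq[OF f]
    by (simp add: N_inf_def Mi.proj_complement complex_vector.scale_right_diff_distrib)
  have 3: "S (- inverse \<zeta> *\<^sub>C d) = V d - inverse \<zeta> *\<^sub>C d"
    using \<zeta> by (simp only: S_def V_scaleC[OF d] complex_vector.scale_scale) simp
  show ?thesis
    unfolding 1 2 3 by (simp add: complex_vector.scale_right_distrib)
qed

lemma range_V_plus:
  "range (\<lambda>x. V_plus D V C x - inverse \<zeta> *\<^sub>C x)
    = {m + y | m y. m \<in> M_space D V \<zeta> \<and> y \<in> (\<lambda>x. C x - W_op D V \<zeta> x) ` N_space D V 0}"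
    (is "range ?U = ?R")
proof (intro equalityI subsetI)
  fix h assume "h \<in> range ?U"
  then obtain x where x: "h = ?U x" by blast
  obtain d f where df: "d \<in> D" "f \<in> N_space D V \<zeta>" "x = d + f" by (rule domain_plus_N_space)
  have "orth_proj (N_space D V 0) f \<in> N_space D V 0"
    using domain_W_op imageI[OF df(2)] by metis
  moreover have "S (- inverse \<zeta> *\<^sub>C d) \<in> M_space D V \<zeta>"
    unfolding M_space_eq using complex_vector.subspace_scale[OF D_subspace df(1)] by blast
  ultimately show "h \<in> ?R"
    using V_plus_decomposed[OF df(1,2), of C] x df(3) by blast
next
  fix h assume "h \<in> ?R"
  then obtain e g where e: "e \<in> D" and g: "g \<in> N_space D V 0"
    and h: "h = S e + (C g - W_op D V \<zeta> g)" by (auto simp: M_space_eq)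
  obtain f where f: "f \<in> N_space D V \<zeta>" and gf: "orth_proj (N_space D V 0) f = g"
    using g domain_W_op by (metis imageE)
  have \<zeta>: "\<zeta> \<noteq> 0" using unit by auto
  have "- \<zeta> *\<^sub>C e \<in> D" using complex_vector.subspace_scale[OF D_subspace e] .
  from V_plus_decomposed[OF this f, of C]
  have "?U (- \<zeta> *\<^sub>C e + f) = S e + (C g - W_op D V \<zeta> g)"
    using \<zeta> gf by (simp add: scaleC_scaleC)
  then have "h = ?U (- \<zeta> *\<^sub>C e + f)" using h by simp
  then show "h \<in> range ?U" by (rule range_eqI)
qed

end

theorem theorem5p2:
  fixes D :: "'a::complex_hilbert set" and V C :: "'a \<Rightarrow> 'a" and \<zeta> :: complex
  assumes "separable_space (euclidean :: 'a topology)"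
    and "closed_isometric D V"
    and "bounded_operator (N_space D V 0) C"
    and "C ` N_space D V 0 \<subseteq> N_inf D V"
    and "cmod \<zeta> = 1"
    and "regular_type D V (inverse \<zeta>)"
  shows "range (\<lambda>x. V_plus D V C x - inverse \<zeta> *\<^sub>C x) = UNIV \<longleftrightarrow>
    (\<lambda>x. C x - W_op D V \<zeta> x) ` N_space D V 0 = N_inf D V \<and>
    orth_proj (M_inf D V) ` M_space D V \<zeta> = M_inf D V"
proof -
  define A where "A = (\<lambda>x. V x - inverse \<zeta> *\<^sub>C x)"
  have \<zeta>: "\<zeta> \<noteq> 0" using assms(5) by auto
  obtain K where inj: "inj_on A D" and K: "\<And>x. x \<in> A ` D \<Longrightarrow> norm (inv_into D A x) \<le> K * norm x"
    using assms(6) by (auto simp: regular_type_def bounded_operator_def A_def Let_def)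
  \<comment> \<open>The bound \<open>K\<close> of the inverse may be \<open>0\<close> or negative when \<open>D\<close> is trivial.\<close>
  define k where "k = 1 / max K 1"
  interpret regular_isometry D V \<zeta> k
  proof
    show "closed_isometric D V" "cmod \<zeta> = 1" using assms by auto
    show "k > 0" by (simp add: k_def)
    fix d assume d: "d \<in> D"
    have "d - \<zeta> *\<^sub>C V d = - \<zeta> *\<^sub>C A d"
      using \<zeta> by (simp add: A_def complex_vector.scale_right_diff_distrib)
    then have "norm (d - \<zeta> *\<^sub>C V d) = norm (A d)"
      using norm_scaleC[of "- \<zeta>" "A d"] assms(5) by simp
    moreover have "norm d \<le> max K 1 * norm (A d)"
      using K[of "A d"] d inv_into_f_f[OF inj d]
        mult_right_mono[of K "max K 1" "norm (A d)"] by simp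
    ultimately show "k * norm d \<le> norm (d - \<zeta> *\<^sub>C V d)"
      by (simp add: k_def field_simps)
  qed
  let ?B = "(\<lambda>x. C x - W_op D V \<zeta> x) ` N_space D V 0"
  let ?Q = "orth_proj (M_inf D V)"
  have subN: "complex_vector.subspace (N_inf D V)"
    by (simp add: N_inf_def subspace_orth_compl)
  have B: "?B \<subseteq> N_inf D V"
  proof
    fix y assume "y \<in> ?B"
    then obtain g where g: "g \<in> N_space D V 0" and y: "y = C g - W_op D V \<zeta> g" by blast
    obtain f where f: "f \<in> N_space D V \<zeta>" "orth_proj (N_space D V 0) f = g"
      using g domain_W_op by (metis imageE)
    then have "W_op D V \<zeta> g = inverse \<zeta> *\<^sub>C orth_proj (N_inf D V) f"
      using W_op_eq[OF f(1)] by simp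
    also have "\<dots> \<in> N_inf D V"
      by (rule complex_vector.subspace_scale[OF subN])
        (simp add: N_inf_def Mi.proj_complement Mi.proj_residual)
    finally show "y \<in> N_inf D V"
      using y g assms(4) complex_vector.subspace_diff[OF subN] by blast
  qed
  show ?thesis
    unfolding range_V_plus
  proof
    assume R: "{m + y | m y. m \<in> M_space D V \<zeta> \<and> y \<in> ?B} = UNIV"
    have split: "\<exists>m\<in>M_space D V \<zeta>. \<exists>y\<in>?B. h = m + y" for h
      using R by blast
    have "N_inf D V \<subseteq> ?B"
    proof
      fix h assume h: "h \<in> N_inf D V"
      obtain m y where my: "m \<in> M_space D V \<zeta>" "y \<in> ?B" "h = m + y" using split by blast
      then have "m \<in> N_inf D V"
        using complex_vector.subspace_diff[OF subN h, of y] B by auto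
      then show "h \<in> ?B" using M_space_inter_N_inf[OF my(1)] my by simp
    qed
    moreover have "M_inf D V \<subseteq> ?Q ` M_space D V \<zeta>"
    proof
      fix h assume h: "h \<in> M_inf D V"
      obtain m y where my: "m \<in> M_space D V \<zeta>" "y \<in> ?B" "h = m + y" using split by blast
      then have "?Q y = 0" using B Mi.proj_orth_compl by (auto simp: N_inf_def)
      then have "h = ?Q m"
        using Mi.proj_fixed[OF h] my(3) by (simp add: Mi.proj_add)
      then show "h \<in> ?Q ` M_space D V \<zeta>" using my(1) by blast
    qed
    ultimately show "?B = N_inf D V \<and> ?Q ` M_space D V \<zeta> = M_inf D V"
      using B Mi.proj_mem by blast
  next
    assume c: "?B = N_inf D V \<and> ?Q ` M_space D V \<zeta> = M_inf D V"
    have "\<exists>m y. h = m + y \<and> m \<in> M_space D V \<zeta> \<and> y \<in> ?B" for h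
    proof -
      have "?Q h \<in> ?Q ` M_space D V \<zeta>" using c Mi.proj_mem by blast
      then obtain m where m: "m \<in> M_space D V \<zeta>" "?Q h = ?Q m" by blast
      then have "h - m \<in> ?B"
        using c Mi.proj_residual[of "h - m"] by (simp add: Mi.proj_diff N_inf_def)
      then show ?thesis using m(1) by (intro exI[of _ m] exI[of _ "h - m"]) simp
    qed
    then show "{m + y | m y. m \<in> M_space D V \<zeta> \<and> y \<in> ?B} = UNIV" by blast
  qed
qed

end
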